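(* Let $\langle\mathcal H,\mathcal O,\phi\rangle$ be an information leakage channel with inputs $h_1,\dots,h_n$, and let a family of constraints on the input probabilities be given, consisting of $C_0\equiv\sum_i h_i=1$ and $C_k\equiv g_k(h)\ge F_k$ for $k=1,\dots,m$, where $g_k(h)=\sum_i h_i f_{i,k}$ with real constants $f_{i,k}$, $F_k$. Let the input probabilities $(h_i)_{1\le i\le n}$ maximize the mutual information $I(h;O)$ among all input probability distributions satisfying these constraints. Then $(h_i)$ is a solution of one of the following two systems (in addition to $\sum_i h_i=1$): (1) there are real numbers $\lambda_0,\lambda_1,\dots,\lambda_m$ with $\lambda_k\ge 0$ for all $1\le k\le m$ such that, with $f_{i,0}=1$, $$\sum_{o_s\in\hat O_i}\phi_{s,i}\ln\Big(\frac{\phi_{s,i}}{o_s}\Big)-1+\sum_{k=0}^m\lambda_k f_{i,k}=0\quad\text{for all } i,\qquad\text{and}\qquad g_k(h)\ge F_k\ \text{ for all } 1\le k\le m;$$ or (2) there is a real number $\lambda_0$ such that $$\sum_{o_s\in\hat O_i}\phi_{s,i}\ln\Big(\frac{\phi_{s,i}}{o_s}\Big)-1+\lambda_0=0\quad\text{for all } i,\qquad\text{and}\qquad g_k(h)\ge F_k\ \text{ for all } 1\le k\le m.$$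
   Context: An information leakage channel is a triple $\langle\mathcal H,\mathcal O,\phi\rangle$, where $\mathcal H=\{h_1,\dots,h_n\}$ is a finite set of confidential inputs, $\mathcal O=\{o_1,o_2,\dots\}$ is a finite set of observations, and $\phi=P(O\mid h)$ is a conditional probability matrix: $\phi_{j,i}$ is the probability of observing $o_j$ given the input $h_i$ (so $\phi_{j,i}\ge 0$ and $\sum_j\phi_{j,i}=1$ for each $i$). Here $h$ is a random variable with values in $\mathcal H$ and $O$ is the resulting random variable with values in $\mathcal O$. Notational convention: $h_i$ also denotes the probability of the input $h_i$, and $o_j$ also denotes the probability of the observation $o_j$, i.e. $o_j=\sum_i h_i\phi_{j,i}$. $\hat O_i$ denotes the set of observations possible for the secret $h_i$, i.e. the set of non-zero observations $o_s$ compatible with input $h_i$ ($\phi_{s,i}\ne 0$, $o_s\neq 0$). $I(h;O)=H(h)-H(h\mid O)=\sum_{i,k}h_i\phi_{k,i}\log_2\frac{\phi_{k,i}}{o_k}$ (Shannon mutual information, with the usual convention that terms with $h_i\phi_{k,i}=0$ are $0$).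
   Formalization: Added hypothesis: whenever the maximizing h_i = 0, the condition h_i ≥ 0 is itself one of the constraints C_k. Without it the claim fails, e.g. inputs with columns (1,0), (0,1), (1/2,1/2) and m = 0, whose only maximizer is (1/2,1/2,0). *)

theory Defs
  imports "HOL-Probability.Probability"
begin

text \<open>The inputs are the elements of a finite type \<open>'h\<close>, the observations those of a finite
  type \<open>'o\<close>. The number \<open>phi j i\<close> is the probability of observing \<open>j\<close> given the input \<open>i\<close>.\<close>

definition channel :: "('o::finite \<Rightarrow> 'h::finite \<Rightarrow> real) \<Rightarrow> bool" where
  "channel phi \<longleftrightarrow> (\<forall>i j. 0 \<le> phi j i) \<and> (\<forall>i. (\<Sum>j\<in>UNIV. phi j i) = 1)"

definition input_distribution :: "('h::finite \<Rightarrow> real) \<Rightarrow> bool" where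
  "input_distribution h \<longleftrightarrow> (\<forall>i. 0 \<le> h i) \<and> (\<Sum>i\<in>UNIV. h i) = 1"

definition obs_prob :: "('o::finite \<Rightarrow> 'h::finite \<Rightarrow> real) \<Rightarrow> ('h \<Rightarrow> real) \<Rightarrow> 'o \<Rightarrow> real" where
  "obs_prob phi h j = (\<Sum>i\<in>UNIV. h i * phi j i)"

definition compatible_obs ::
    "('o::finite \<Rightarrow> 'h::finite \<Rightarrow> real) \<Rightarrow> ('h \<Rightarrow> real) \<Rightarrow> 'h \<Rightarrow> 'o set" where
  "compatible_obs phi h i = {s. phi s i \<noteq> 0 \<and> obs_prob phi h s \<noteq> 0}"

text \<open>The joint law of input and observation. The definition is meaningful when \<open>phi\<close> is a
  channel and \<open>h\<close> an input distribution; see \<open>pmf_joint_dist\<close>.\<close>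

definition joint_dist ::
    "('o::finite \<Rightarrow> 'h::finite \<Rightarrow> real) \<Rightarrow> ('h \<Rightarrow> real) \<Rightarrow> ('h \<times> 'o) pmf" where
  "joint_dist phi h = embed_pmf (\<lambda>(i, j). h i * phi j i)"

text \<open>\<open>I(h;O)\<close> in bits. The lemmas below give the forms \<open>H(h) - H(h|O)\<close> and
  \<open>\<Sum>i,k. h i * phi k i * log 2 (phi k i / o k)\<close>.\<close>

definition mutual_info :: "('o::finite \<Rightarrow> 'h::finite \<Rightarrow> real) \<Rightarrow> ('h \<Rightarrow> real) \<Rightarrow> real" where
  "mutual_info phi h = prob_space.mutual_information (measure_pmf (joint_dist phi h)) 2
     (count_space UNIV) (count_space UNIV) fst snd"

text \<open>The requirement that the probability of input \<open>i\<close> be nonnegative is itself one of the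
  constraints \<open>g k h \<ge> F k\<close>. The stationarity equations of the theorem carry no multiplier for
  the sign conditions on the input probabilities, so a sign condition that is binding at the
  maximizer has to be part of the family. Otherwise the equations can fail: in the channel with
  inputs 1, 2, 3 and observations a, b that sends 1 to a, 2 to b and 3 to either with probability
  1/2, the only maximizer without further constraints is (1/2, 1/2, 0), and the sums in the
  equations are \<open>ln 2\<close>, \<open>ln 2\<close> and 0.\<close>

definition nonneg_listed ::
    "nat \<Rightarrow> ('h::finite \<Rightarrow> nat \<Rightarrow> real) \<Rightarrow> (nat \<Rightarrow> real) \<Rightarrow> 'h \<Rightarrow> bool" where
  "nonneg_listed m f F i \<longleftrightarrow>
     (\<exists>k\<in>{1..m}. F k = 0 \<and> (\<forall>j. f j k = (if j = i then 1 else 0)))"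

lemma pmf_joint_dist:
  assumes "channel phi" "input_distribution h"
  shows "pmf (joint_dist phi h) (i, j) = h i * phi j i"
proof -
  have nn: "0 \<le> (case x of (i, j) \<Rightarrow> h i * phi j i)" for x
    using assms by (auto simp: channel_def input_distribution_def split: prod.split)
  have "(\<integral>\<^sup>+x. ennreal (case x of (i, j) \<Rightarrow> h i * phi j i) \<partial>count_space UNIV) =
      (\<Sum>x\<in>UNIV. ennreal (case x of (i, j) \<Rightarrow> h i * phi j i))"
    by (rule nn_integral_count_space_finite) simp
  also have "\<dots> = ennreal (\<Sum>x\<in>UNIV. case x of (i, j) \<Rightarrow> h i * phi j i)"
    by (rule sum_ennreal) (rule nn)
  also have "(\<Sum>x\<in>UNIV. case x of (i, j) \<Rightarrow> h i * phi j i)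
      = (\<Sum>i\<in>UNIV. h i * (\<Sum>j\<in>UNIV. phi j i))"
    by (simp add: UNIV_Times_UNIV[symmetric] sum.cartesian_product sum_distrib_left
        del: UNIV_Times_UNIV)
  also have "\<dots> = 1"
    using assms by (simp add: channel_def input_distribution_def)
  finally show ?thesis
    unfolding joint_dist_def by (subst pmf_embed_pmf) (use nn in auto)
qed

lemma information_space_joint_dist: "information_space (measure_pmf (joint_dist phi h)) 2"
  by (simp add: information_space_def information_space_axioms_def
      measure_pmf.prob_space_axioms)

lemma mutual_info_eq_entropy_conditional_entropy:
  "mutual_info phi h =
     prob_space.entropy (measure_pmf (joint_dist phi h)) 2 (count_space UNIV) fst
   - prob_space.conditional_entropy (measure_pmf (joint_dist phi h)) 2
       (count_space UNIV) (count_space UNIV) fst snd"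
proof -
  interpret information_space "measure_pmf (joint_dist phi h)" 2
    by (rule information_space_joint_dist)
  have *: "simple_function (measure_pmf (joint_dist phi h)) fst"
    "simple_function (measure_pmf (joint_dist phi h)) snd"
    by (auto simp: simple_function_def)
  show ?thesis
    using mutual_information_eq_entropy_conditional_entropy[OF *]
    by (simp add: mutual_info_def)
qed

lemma mutual_info_eq_sum:
  assumes "channel phi" "input_distribution h"
  shows "mutual_info phi h =
    (\<Sum>i\<in>UNIV. \<Sum>k\<in>UNIV. h i * phi k i * log 2 (phi k i / obs_prob phi h k))"
proof -
  let ?J = "joint_dist phi h"
  interpret information_space "measure_pmf ?J" 2
    by (rule information_space_joint_dist)
  have m: "measure (measure_pmf ?J) A = (\<Sum>x\<in>A. pmf ?J x)" for A
    by (simp add: measure_measure_pmf_finite)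
  have X: "simple_distributed (measure_pmf ?J) fst h"
  proof (rule measure_pmf.simple_distributedI)
    fix i assume "i \<in> fst ` space (measure_pmf ?J)"
    have "fst -` {i} \<inter> space (measure_pmf ?J) = {i} \<times> (UNIV :: 'a set)" by auto
    moreover have "(\<Sum>x\<in>{i} \<times> UNIV. pmf ?J x) = (\<Sum>i'\<in>{i}. \<Sum>k\<in>UNIV. pmf ?J (i', k))"
      unfolding sum.cartesian_product by (rule sum.cong) auto
    moreover have "\<dots> = h i"
      using assms by (simp add: pmf_joint_dist sum_distrib_left[symmetric] channel_def)
    ultimately show "h i = measure (measure_pmf ?J) (fst -` {i} \<inter> space (measure_pmf ?J))"
      by (simp only: m)
  qed (use assms in \<open>auto simp: simple_function_def input_distribution_def\<close>)
  have Y: "simple_distributed (measure_pmf ?J) snd (obs_prob phi h)"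
  proof (rule measure_pmf.simple_distributedI)
    fix j assume "j \<in> snd ` space (measure_pmf ?J)"
    have "snd -` {j} \<inter> space (measure_pmf ?J) = (UNIV :: 'b set) \<times> {j}" by auto
    moreover have "(\<Sum>x\<in>UNIV \<times> {j}. pmf ?J x) = (\<Sum>i\<in>UNIV. \<Sum>k\<in>{j}. pmf ?J (i, k))"
      unfolding sum.cartesian_product by (rule sum.cong) auto
    moreover have "\<dots> = obs_prob phi h j"
      using assms by (simp add: pmf_joint_dist obs_prob_def)
    ultimately show "obs_prob phi h j = measure (measure_pmf ?J) (snd -` {j} \<inter> space (measure_pmf ?J))"
      by (simp only: m)
  qed (use assms in \<open>auto simp: simple_function_def input_distribution_def channel_def
      obs_prob_def intro!: sum_nonneg\<close>)
  have XY: "simple_distributed (measure_pmf ?J) (\<lambda>x. (fst x, snd x)) (\<lambda>x. pmf ?J x)"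
    by (rule measure_pmf.simple_distributedI) (auto simp: simple_function_def vimage_def m)
  have "mutual_info phi h = (\<Sum>(i, k)\<in>UNIV \<times> UNIV.
      pmf ?J (i, k) * log 2 (pmf ?J (i, k) / (h i * obs_prob phi h k)))"
    using mutual_information_simple_distributed[OF X Y XY]
    by (simp add: mutual_info_def)
  also have "\<dots> = (\<Sum>i\<in>UNIV. \<Sum>k\<in>UNIV.
      h i * phi k i * log 2 (phi k i / obs_prob phi h k))"
    unfolding sum.cartesian_product[symmetric]
    by (intro sum.cong refl) (auto simp: pmf_joint_dist[OF assms])
  finally show ?thesis .
qed

end

theory Submission
  imports Defs
begin

text \<open>On the input simplex, the mutual information in nats is a linear function of the input
  probabilities minus \<open>\<Sum>k. o k * ln (o k)\<close>. Along a direction \<open>d\<close> that keeps all binding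
  constraints, its difference quotient at the maximizer is bounded from below, by convexity of
  \<open>x ln x\<close>, by a quantity that tends to \<open>\<Sum>i. d i * S i\<close> with \<open>S i\<close> the sum of the stationarity
  equation, or to infinity if \<open>d\<close> makes an observation of probability zero possible. Hence there
  is no \<open>d\<close> of the second kind, and \<open>\<Sum>i. d i * S i \<le> 0\<close> for every such \<open>d\<close>; Farkas' lemma turns
  this into multipliers. All constraints being affine, no constraint qualification is needed.\<close>

section \<open>Farkas' lemma for linear functionals\<close>

text \<open>Induction on the number of inequalities. If the new inequality is implied by the others
  as far as \<open>b\<close> is concerned, its multiplier is 0. Otherwise a point \<open>y\<close>
  witnessing the failure has \<open>a n y < 0\<close>, and projecting along \<open>y\<close> onto
  the kernel of \<open>a n\<close> leaves a problem with the remaining inequalities. The multiplier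
  \<open>c\<close> has no sign because \<open>e x = 0\<close> is an equation.\<close>

lemma farkas_linear:
  fixes e b :: "'v::real_vector \<Rightarrow> real" and a :: "'k \<Rightarrow> 'v \<Rightarrow> real"
  assumes "finite A" "linear e" "\<And>k. k \<in> A \<Longrightarrow> linear (a k)" "linear b"
    and "\<And>x. e x = 0 \<Longrightarrow> (\<And>k. k \<in> A \<Longrightarrow> 0 \<le> a k x) \<Longrightarrow> 0 \<le> b x"
  shows "\<exists>c l. (\<forall>k\<in>A. 0 \<le> l k) \<and> (\<forall>x. b x = c * e x + (\<Sum>k\<in>A. l k * a k x))"
  using assms(1,3-5)
proof (induction A arbitrary: a b rule: finite_induct)
  case empty
  have b0: "b x = 0" if "e x = 0" for x
  proof -
    have "0 \<le> b x" "0 \<le> b (- x)"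
      using empty(3) that linear_neg[OF assms(2), of x] by auto
    then show ?thesis using linear_neg[OF empty(2), of x] by simp
  qed
  show ?case
  proof (cases "\<exists>z. e z \<noteq> 0")
    case True
    then obtain z where z: "e z \<noteq> 0" by blast
    define c where "c = b z / e z"
    have "b x = c * e x" for x
    proof -
      have "e (x - (e x / e z) *\<^sub>R z) = 0"
        using z by (simp add: linear_diff[OF assms(2)] linear_scale[OF assms(2)])
      from b0[OF this] show ?thesis
        by (simp add: c_def linear_diff[OF empty(2)] linear_scale[OF empty(2)] mult.commute)
    qed
    then show ?thesis by (intro exI[of _ c]) simp
  next
    case False
    then show ?thesis using b0 by (intro exI[of _ 0]) simp
  qed
next
  case (insert n A)
  note lin = insert.prems(1) insert.prems(2)
  show ?case
  proof (cases "\<forall>x. e x = 0 \<longrightarrow> (\<forall>k\<in>A. 0 \<le> a k x) \<longrightarrow> 0 \<le> b x")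
    case True
    then obtain c l where l: "\<forall>k\<in>A. 0 \<le> l k"
      "\<And>x. b x = c * e x + (\<Sum>k\<in>A. l k * a k x)"
      using insert.IH[of a b] lin by auto
    have "(\<Sum>k\<in>insert n A. (l(n := 0)) k * a k x) = (\<Sum>k\<in>A. l k * a k x)" for x
      using insert.hyps by (auto intro!: sum.cong)
    then show ?thesis using l insert.hyps
      by (intro exI[of _ c] exI[of _ "l(n := 0)"]) auto
  next
    case False
    then obtain y where y: "e y = 0" "\<And>k. k \<in> A \<Longrightarrow> 0 \<le> a k y" "b y < 0"
      by (auto simp: not_le)
    have ay: "a n y < 0" using insert.prems(3)[of y] y by force
    \<comment> \<open>The projection along \<open>y\<close> onto the kernel of \<open>a n\<close>.
      It preserves \<open>e\<close> because \<open>e y = 0\<close>.\<close>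
    define P where "P x = x - (a n x / a n y) *\<^sub>R y" for x
    have comp: "g (P x) = g x - a n x / a n y * g y" if "linear g" for g :: "'v \<Rightarrow> real" and x
      by (simp add: P_def linear_diff[OF that] linear_scale[OF that])
    have "linear P"
      unfolding P_def using lin(1)[of n]
      by (intro linearI)
        (auto simp: linear_add linear_scale algebra_simps add_divide_distrib)
    then have linP: "linear (\<lambda>x. g (P x))" if "linear g" for g :: "'v \<Rightarrow> real"
      using linear_compose[OF _ that] by (simp add: o_def)
    have "0 \<le> b (P x)" if "e x = 0" "\<And>k. k \<in> A \<Longrightarrow> 0 \<le> a k (P x)" for x
      using that comp[OF assms(2), of x] comp[OF lin(1)[of n], of x] y ay
      by (intro insert.prems(3)) auto
    then obtain c l where l: "\<forall>k\<in>A. 0 \<le> l k"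
      "\<And>x. b (P x) = c * e x + (\<Sum>k\<in>A. l k * a k (P x))"
      using insert.IH[of "\<lambda>k x. a k (P x)" "\<lambda>x. b (P x)"] lin linP by auto
    \<comment> \<open>The value forced by evaluating the desired identity at \<open>y\<close>, where
      \<open>e\<close> vanishes. Numerator and denominator are both negative.\<close>
    define q where "q = (b y - (\<Sum>k\<in>A. l k * a k y)) / a n y"
    have "0 \<le> (\<Sum>k\<in>A. l k * a k y)" using l(1) y(2) by (intro sum_nonneg) auto
    then have q: "0 \<le> q" unfolding q_def using y(3) ay by (intro divide_nonpos_nonpos) auto
    have "b x = c * e x + (\<Sum>k\<in>insert n A. (l(n := q)) k * a k x)" for x
    proof -
      have "(\<Sum>k\<in>A. l k * a k (P x)) =
          (\<Sum>k\<in>A. l k * a k x - a n x / a n y * (l k * a k y))"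
        by (intro sum.cong refl) (simp add: comp[OF lin(1)] algebra_simps)
      also have "\<dots> = (\<Sum>k\<in>A. l k * a k x) - a n x / a n y * (\<Sum>k\<in>A. l k * a k y)"
        by (simp add: sum_subtractf sum_distrib_left)
      finally have "b x = c * e x + (\<Sum>k\<in>A. l k * a k x) + q * a n x"
        using l(2)[of x] comp[OF lin(2), of x] by (simp add: q_def diff_divide_distrib algebra_simps)
      moreover have "(\<Sum>k\<in>A. (l(n := q)) k * a k x) = (\<Sum>k\<in>A. l k * a k x)"
        using insert.hyps by (intro sum.cong) auto
      ultimately show ?thesis using insert.hyps by simp
    qed
    then show ?thesis using l(1) q insert.hyps
      by (intro exI[of _ c] exI[of _ "l(n := q)"]) auto
  qed
qed

section \<open>One-sided limits of affine and logarithmic terms\<close>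

lemma eventually_affine_pos:
  fixes c e :: real
  assumes "0 < c"
  shows "\<forall>\<^sub>F t in at_right 0. 0 < c + t * e"
proof -
  have "((\<lambda>t. c + t * e) \<longlongrightarrow> c + 0 * e) (at_right 0)" by (intro tendsto_intros)
  then show ?thesis using assms by (intro order_tendstoD(1)) auto
qed

lemma eventually_affine_nonneg:
  fixes c e :: real
  assumes "0 \<le> c" "c = 0 \<Longrightarrow> 0 \<le> e"
  shows "\<forall>\<^sub>F t in at_right 0. 0 \<le> c + t * e"
proof (cases "c = 0")
  case True
  then show ?thesis using assms eventually_at_right_less[of "0::real"]
    by (auto elim!: eventually_mono)
next
  case False
  then show ?thesis using eventually_affine_pos[of c e] assms
    by (auto elim!: eventually_mono)
qed

text \<open>The tangent inequality of the convex function \<open>x ln x\<close>, with the tangent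
  taken at \<open>u\<close>: along a direction, \<open>u\<close> is the moved point, so the slope is
  still finite when the base point \<open>v\<close> is 0 and \<open>u\<close> is positive.\<close>

lemma xlnx_diff_le:
  fixes u v :: real
  assumes "0 \<le> u" "0 \<le> v" "u = 0 \<Longrightarrow> v = 0"
  shows "u * ln u - v * ln v \<le> (u - v) * (1 + ln u)"
proof (cases "v = 0")
  case True
  then show ?thesis using assms by (simp add: algebra_simps)
next
  case False
  then have uv: "0 < u" "0 < v" using assms by (auto simp: less_le)
  have "v * ln (u / v) \<le> v * (u / v - 1)"
    using uv by (intro mult_left_mono ln_le_minus_one) auto
  then show ?thesis using uv by (simp add: ln_div algebra_simps)
qed

lemma mult_ln_affine_tendsto:
  fixes v e :: real
  assumes "0 < v \<or> e = 0"
  shows "((\<lambda>t. e * (1 + ln (v + t * e))) \<longlongrightarrow> e * (1 + ln v)) (at_right 0)"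
proof (cases "e = 0")
  case False
  then have "((\<lambda>t. e * (1 + ln (v + t * e))) \<longlongrightarrow> e * (1 + ln (v + 0 * e))) (at_right 0)"
    using assms by (intro tendsto_intros) auto
  then show ?thesis by simp
qed simp

text \<open>The infinite slope of \<open>x ln x\<close> at 0; this is the behaviour of a term with
  \<open>v k = 0 < e k\<close> in the sum bounded next.\<close>

lemma mult_ln_linear_at_bot:
  fixes e :: real
  assumes "0 < e"
  shows "filterlim (\<lambda>t. e * (1 + ln (0 + t * e))) at_bot (at_right 0)"
proof -
  have "filterlim (\<lambda>t. e * (1 + ln (t * e))) at_bot (at_right 0)"
  proof (rule filterlim_tendsto_pos_mult_at_bot[OF tendsto_const assms])
    have "((\<lambda>t. t * e) \<longlongrightarrow> 0 * e) (at_right 0)" by (intro tendsto_intros)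
    then have "filterlim (\<lambda>t. t * e) (at_right 0) (at_right 0)"
      using assms eventually_at_right_less[of "0::real"]
      by (auto simp: filterlim_at elim!: eventually_mono)
    then have "filterlim (\<lambda>t. ln (t * e)) at_bot (at_right 0)"
      by (rule filterlim_compose[OF ln_at_0])
    then show "filterlim (\<lambda>t. 1 + ln (t * e)) at_bot (at_right 0)"
      by (rule filterlim_tendsto_add_at_bot_iff[OF tendsto_const, THEN iffD2])
  qed
  then show ?thesis by simp
qed

text \<open>Each term is eventually bounded above, so nothing could compensate a term tending to
  minus infinity, and the lower bound \<open>L\<close> excludes such terms. All terms then converge
  and the bound passes to the limit.\<close>

lemma sum_mult_ln_affine_bound:
  fixes v e :: "'k \<Rightarrow> real"
  assumes "finite K" and v: "\<And>k. k \<in> K \<Longrightarrow> 0 \<le> v k"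
    and e: "\<And>k. k \<in> K \<Longrightarrow> v k = 0 \<Longrightarrow> 0 \<le> e k"
    and L: "\<forall>\<^sub>F t in at_right 0. L \<le> (\<Sum>k\<in>K. e k * (1 + ln (v k + t * e k)))"
  shows "(\<forall>k\<in>K. v k = 0 \<longrightarrow> e k = 0) \<and> L \<le> (\<Sum>k\<in>K. e k * (1 + ln (v k)))"
proof -
  let ?g = "\<lambda>k t. e k * (1 + ln (v k + t * e k))"
  have upper: "\<exists>B. \<forall>\<^sub>F t in at_right 0. ?g k t \<le> B" if "k \<in> K" for k
  proof (cases "0 < v k \<or> e k = 0")
    case True
    from order_tendstoD(2)[OF mult_ln_affine_tendsto[OF this], of "e k * (1 + ln (v k)) + 1"]
    show ?thesis
      by (intro exI[of _ "e k * (1 + ln (v k)) + 1"]) (auto elim!: eventually_mono)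
  next
    case False
    then have "v k = 0" "0 < e k" using v[OF that] e[OF that] by auto
    then show ?thesis using mult_ln_linear_at_bot[of "e k"]
      by (auto simp: filterlim_at_bot)
  qed
  then obtain B where B: "\<And>k. k \<in> K \<Longrightarrow> \<forall>\<^sub>F t in at_right 0. ?g k t \<le> B k" by metis
  have zero: "e k = 0" if k: "k \<in> K" "v k = 0" for k
  proof (rule ccontr)
    assume "e k \<noteq> 0"
    then have "filterlim (?g k) at_bot (at_right 0)"
      using e[OF k] k mult_ln_linear_at_bot[of "e k"] by auto
    \<comment> \<open>The threshold is chosen so that the other terms, at most \<open>B j\<close>
      each, cannot lift the sum back to \<open>L\<close>.\<close>
    then have "\<forall>\<^sub>F t in at_right 0. ?g k t < L - (\<Sum>j\<in>K - {k}. B j)"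
      by (auto simp: filterlim_at_bot_dense)
    moreover have "\<forall>\<^sub>F t in at_right 0. \<forall>j\<in>K - {k}. ?g j t \<le> B j"
      using B \<open>finite K\<close> by (intro eventually_ball_finite) auto
    ultimately have "\<forall>\<^sub>F t in at_right (0::real). False"
      using L
    proof eventually_elim
      case (elim t)
      have "(\<Sum>j\<in>K - {k}. ?g j t) \<le> (\<Sum>j\<in>K - {k}. B j)"
        using elim by (intro sum_mono) auto
      then show ?case using elim sum.remove[OF \<open>finite K\<close> k(1), of "\<lambda>j. ?g j t"] by simp
    qed
    then show False by simp
  qed
  have "((\<lambda>t. \<Sum>k\<in>K. ?g k t) \<longlongrightarrow> (\<Sum>k\<in>K. e k * (1 + ln (v k)))) (at_right 0)"
    using zero v by (intro tendsto_sum mult_ln_affine_tendsto) force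
  then have "L \<le> (\<Sum>k\<in>K. e k * (1 + ln (v k)))"
    using L by (intro tendsto_lowerbound) auto
  then show ?thesis using zero by blast
qed

section \<open>Observation probabilities and mutual information in nats\<close>

lemma obs_prob_nonneg:
  assumes "channel phi" "input_distribution p"
  shows "0 \<le> obs_prob phi p j"
  using assms by (auto simp: channel_def input_distribution_def obs_prob_def intro!: sum_nonneg)

lemma obs_prob_add_scale:
  "obs_prob phi (\<lambda>i. p i + t * d i) j = obs_prob phi p j + t * obs_prob phi d j"
  by (simp add: obs_prob_def algebra_simps sum.distrib sum_distrib_left)

lemma obs_prob_eq_0_iff:
  assumes "channel phi" "input_distribution p"
  shows "obs_prob phi p j = 0 \<longleftrightarrow> (\<forall>i. p i * phi j i = 0)"
  unfolding obs_prob_def using assms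
  by (subst sum_nonneg_eq_0_iff) (auto simp: channel_def input_distribution_def)

text \<open>Signs of \<open>d\<close> are arbitrary, so this covers directions: one that keeps the
  total input mass keeps the total observation mass.\<close>

lemma sum_obs_prob:
  assumes "channel phi"
  shows "(\<Sum>j\<in>UNIV. obs_prob phi d j) = (\<Sum>i\<in>UNIV. d i)"
  unfolding obs_prob_def using assms
  by (subst sum.swap) (simp add: channel_def sum_distrib_left[symmetric])

lemma sum_obs_prob_mult:
  "(\<Sum>j\<in>UNIV. obs_prob phi d j * g j) = (\<Sum>i\<in>UNIV. d i * (\<Sum>j\<in>UNIV. phi j i * g j))"
  unfolding obs_prob_def sum_distrib_right sum_distrib_left
  by (subst sum.swap) (simp add: mult.assoc)

text \<open>Splitting the logarithm of the quotient separates a part linear in \<open>p\<close> from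
  the entropy of the observation. The splitting is legitimate where \<open>p i * phi j i\<close> is
  nonzero, and all other terms vanish on both sides.\<close>

lemma mutual_info_nats:
  assumes "channel phi" "input_distribution p"
  shows "mutual_info phi p * ln 2 =
    (\<Sum>i\<in>UNIV. p i * (\<Sum>j\<in>UNIV. phi j i * ln (phi j i)))
    - (\<Sum>j\<in>UNIV. obs_prob phi p j * ln (obs_prob phi p j))"
proof -
  have term_eq: "p i * phi j i * log 2 (phi j i / obs_prob phi p j) * ln 2 =
      p i * (phi j i * ln (phi j i)) - p i * (phi j i * ln (obs_prob phi p j))" for i j
  proof (cases "p i * phi j i = 0")
    case False
    then have "obs_prob phi p j \<noteq> 0" "phi j i \<noteq> 0"
      using obs_prob_eq_0_iff[OF assms] by auto
    then have "0 < obs_prob phi p j" "0 < phi j i"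
      using obs_prob_nonneg[OF assms, of j] assms(1) by (auto simp: channel_def less_le)
    then show ?thesis by (simp add: log_def ln_div right_diff_distrib mult.assoc)
  qed auto
  show ?thesis
    unfolding mutual_info_eq_sum[OF assms] sum_obs_prob_mult
    by (simp add: sum_distrib_right sum_distrib_left term_eq sum_subtractf)
qed

section \<open>First-order condition along a direction\<close>

lemma mutual_info_first_order_condition:
  fixes phi :: "'o::finite \<Rightarrow> 'h::finite \<Rightarrow> real"
  assumes ch: "channel phi" and h: "input_distribution h"
    and d_sum: "(\<Sum>i\<in>UNIV. d i) = 0" and d_nonneg: "\<And>i. h i = 0 \<Longrightarrow> 0 \<le> d i"
    and le: "\<forall>\<^sub>F t in at_right 0. mutual_info phi (\<lambda>i. h i + t * d i) \<le> mutual_info phi h"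
  shows "(\<Sum>i\<in>UNIV. d i *
    (\<Sum>s\<in>compatible_obs phi h i. phi s i * ln (phi s i / obs_prob phi h s))) \<le> 0"
proof -
  let ?v = "obs_prob phi h" and ?e = "obs_prob phi d"
  \<comment> \<open>The slope along \<open>d\<close> of the linear part in
    \<open>mutual_info_nats\<close>.\<close>
  define L where "L = (\<Sum>i\<in>UNIV. d i * (\<Sum>j\<in>UNIV. phi j i * ln (phi j i)))"
  have phi0: "0 \<le> phi j i" for i j using ch by (simp add: channel_def)
  have v0: "0 \<le> ?v j" for j by (rule obs_prob_nonneg[OF ch h])
  \<comment> \<open>An input that can cause an observation of probability 0 has probability 0
    itself, so its \<open>d i\<close> is nonnegative.\<close>
  have summand: "0 \<le> d i * phi j i" if "?v j = 0" for i j
    using that obs_prob_eq_0_iff[OF ch h, of j] d_nonneg phi0 by (cases "h i = 0") auto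
  then have e0: "0 \<le> ?e j" if "?v j = 0" for j
    using that by (auto simp: obs_prob_def[of phi d] intro!: sum_nonneg)
  have "\<forall>\<^sub>F t in at_right 0. \<forall>i. 0 \<le> h i + t * d i"
    using h d_nonneg
    by (intro eventually_all_finite eventually_affine_nonneg) (auto simp: input_distribution_def)
  moreover have "\<forall>\<^sub>F t in at_right 0. \<forall>j. 0 < ?v j \<longrightarrow> 0 < ?v j + t * ?e j"
    by (intro eventually_all_finite) (auto intro: eventually_affine_pos)
  ultimately have "\<forall>\<^sub>F t in at_right 0. L \<le> (\<Sum>j\<in>UNIV. ?e j * (1 + ln (?v j + t * ?e j)))"
    using le eventually_at_right_less[of "0::real"]
  proof eventually_elim
    case (elim t)
    let ?p = "\<lambda>i. h i + t * d i"
    have p: "input_distribution ?p"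
      using elim(1) h d_sum
      by (auto simp: input_distribution_def sum.distrib sum_distrib_left[symmetric])
    have u: "?v j + t * ?e j \<ge> 0" for j
      using obs_prob_nonneg[OF ch p, of j] by (simp add: obs_prob_add_scale)
    have "mutual_info phi ?p * ln 2 \<le> mutual_info phi h * ln 2"
      using elim(3) by (intro mult_right_mono) auto
    then have "t * L \<le> (\<Sum>j\<in>UNIV. (?v j + t * ?e j) * ln (?v j + t * ?e j) - ?v j * ln (?v j))"
      unfolding mutual_info_nats[OF ch p] mutual_info_nats[OF ch h] obs_prob_add_scale L_def
      by (simp add: distrib_right sum.distrib sum_distrib_left sum_subtractf mult.assoc)
    also have "\<dots> \<le> (\<Sum>j\<in>UNIV. (?v j + t * ?e j - ?v j) * (1 + ln (?v j + t * ?e j)))"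
    proof (intro sum_mono xlnx_diff_le)
      fix j assume "?v j + t * ?e j = 0"
      then show "?v j = 0" using elim(2) v0[of j] by (force simp: less_le)
    qed (use u v0 in auto)
    also have "\<dots> = t * (\<Sum>j\<in>UNIV. ?e j * (1 + ln (?v j + t * ?e j)))"
      by (simp add: sum_distrib_left mult.assoc)
    finally show ?case using elim(4) by simp
  qed
  from sum_mult_ln_affine_bound[OF finite v0 e0 this]
  have e_zero: "\<And>j. ?v j = 0 \<Longrightarrow> ?e j = 0" and "L \<le> (\<Sum>j\<in>UNIV. ?e j * (1 + ln (?v j)))"
    by auto
  \<comment> \<open>The constant 1 in the slope of \<open>x ln x\<close> drops out because
    \<open>?e\<close> sums to 0.\<close>
  then have L: "L - (\<Sum>j\<in>UNIV. ?e j * ln (?v j)) \<le> 0"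
    using sum_obs_prob[OF ch, of d] d_sum by (simp add: distrib_left sum.distrib)
  \<comment> \<open>Nonnegative terms with sum \<open>?e j = 0\<close> vanish one by one.\<close>
  have summand0: "d i * phi j i = 0" if "?v j = 0" for i j
  proof -
    have "(\<Sum>i\<in>UNIV. d i * phi j i) = 0" using e_zero[OF that] by (simp add: obs_prob_def)
    then show ?thesis using summand[OF that] by (subst (asm) sum_nonneg_eq_0_iff) auto
  qed
  have "d i * (\<Sum>s\<in>compatible_obs phi h i. phi s i * ln (phi s i / ?v s)) =
      d i * (\<Sum>j\<in>UNIV. phi j i * ln (phi j i)) - d i * (\<Sum>j\<in>UNIV. phi j i * ln (?v j))" for i
  proof -
    have "d i * (\<Sum>s\<in>compatible_obs phi h i. phi s i * ln (phi s i / ?v s)) =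
        (\<Sum>s\<in>compatible_obs phi h i. d i * phi s i * (ln (phi s i) - ln (?v s)))"
      unfolding sum_distrib_left
    proof (intro sum.cong refl)
      fix s assume "s \<in> compatible_obs phi h i"
      then have "0 < phi s i" "0 < ?v s"
        using phi0[of s i] v0[of s] by (auto simp: compatible_obs_def)
      then show "d i * (phi s i * ln (phi s i / ?v s)) =
          d i * phi s i * (ln (phi s i) - ln (?v s))"
        by (simp add: ln_div)
    qed
    \<comment> \<open>An observation outside \<open>compatible_obs\<close> may have
      \<open>phi s i\<close> nonzero and probability 0; the factor \<open>d i\<close> is what makes
      its term vanish.\<close>
    also have "\<dots> = (\<Sum>s\<in>UNIV. d i * phi s i * (ln (phi s i) - ln (?v s)))"
      using summand0 by (intro sum.mono_neutral_left) (auto simp: compatible_obs_def)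
    finally show ?thesis
      by (simp add: sum_distrib_left sum_subtractf right_diff_distrib mult.assoc)
  qed
  then have "(\<Sum>i\<in>UNIV. d i *
      (\<Sum>s\<in>compatible_obs phi h i. phi s i * ln (phi s i / ?v s))) =
      L - (\<Sum>j\<in>UNIV. ?e j * ln (?v j))"
    by (simp only: sum_subtractf[symmetric] L_def sum_obs_prob_mult)
  then show ?thesis using L by simp
qed

section \<open>Multipliers from the binding constraints\<close>

theorem theorem3p1:
  fixes phi :: "'o::finite \<Rightarrow> 'h::finite \<Rightarrow> real"
    and m :: nat
    and f :: "'h \<Rightarrow> nat \<Rightarrow> real"
    and F :: "nat \<Rightarrow> real"
    and h :: "'h \<Rightarrow> real"
  assumes "channel phi"
    and f0: "\<forall>i. f i 0 = 1"
    and maximizer: "is_arg_max (mutual_info phi)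
      (\<lambda>p. input_distribution p \<and> (\<forall>k\<in>{1..m}. (\<Sum>i\<in>UNIV. p i * f i k) \<ge> F k)) h"
    and binding_listed: "\<forall>i. h i = 0 \<longrightarrow> nonneg_listed m f F i"
  shows "(\<Sum>i\<in>UNIV. h i) = 1 \<and>
    ((\<exists>l :: nat \<Rightarrow> real.
        (\<forall>k\<in>{1..m}. l k \<ge> 0) \<and>
        (\<forall>i. (\<Sum>s\<in>compatible_obs phi h i. phi s i * ln (phi s i / obs_prob phi h s)) - 1
              + (\<Sum>k=0..m. l k * f i k) = 0) \<and>
        (\<forall>k\<in>{1..m}. (\<Sum>i\<in>UNIV. h i * f i k) \<ge> F k))
     \<or> (\<exists>l0 :: real.
        (\<forall>i. (\<Sum>s\<in>compatible_obs phi h i. phi s i * ln (phi s i / obs_prob phi h s)) - 1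
              + l0 = 0) \<and>
        (\<forall>k\<in>{1..m}. (\<Sum>i\<in>UNIV. h i * f i k) \<ge> F k)))"
proof -
  let ?feas = "\<lambda>p. input_distribution p \<and> (\<forall>k\<in>{1..m}. (\<Sum>i\<in>UNIV. p i * f i k) \<ge> F k)"
  define S where "S i =
    (\<Sum>s\<in>compatible_obs phi h i. phi s i * ln (phi s i / obs_prob phi h s))" for i
  define A where "A = {k\<in>{1..m}. (\<Sum>i\<in>UNIV. h i * f i k) = F k}"
  have h: "input_distribution h" and g: "\<forall>k\<in>{1..m}. (\<Sum>i\<in>UNIV. h i * f i k) \<ge> F k"
    and max: "\<And>p. ?feas p \<Longrightarrow> mutual_info phi p \<le> mutual_info phi h"
    using maximizer by (auto simp: is_arg_max_def not_less)
  have first_order: "(\<Sum>i\<in>UNIV. d i * S i) \<le> 0"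
    if d_sum: "(\<Sum>i\<in>UNIV. d i) = 0" and d_A: "\<And>k. k \<in> A \<Longrightarrow> 0 \<le> (\<Sum>i\<in>UNIV. d i * f i k)" for d
  proof -
    \<comment> \<open>By \<open>binding_listed\<close>, the sign condition on \<open>h i\<close> is
      one of the constraints, and \<open>h i = 0\<close> makes it binding, so its index lies in
      \<open>A\<close>.\<close>
    have d_nonneg: "0 \<le> d i" if hi: "h i = 0" for i
    proof -
      obtain k where k: "k \<in> {1..m}" "F k = 0" "\<And>j. f j k = (if j = i then 1 else 0)"
        using binding_listed hi unfolding nonneg_listed_def by metis
      then have "(\<Sum>j\<in>UNIV. x j * f j k) = x i" for x :: "'h \<Rightarrow> real"
        by (simp add: if_distrib[of "\<lambda>y. _ * y"] cong: if_cong)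
      then show ?thesis using d_A[of k] k hi by (simp add: A_def)
    qed
    have "\<forall>\<^sub>F t in at_right 0. \<forall>i. 0 \<le> h i + t * d i"
      using h d_nonneg
      by (intro eventually_all_finite eventually_affine_nonneg) (auto simp: input_distribution_def)
    \<comment> \<open>Constraints outside \<open>A\<close> have slack and survive small
      \<open>t\<close>; those in \<open>A\<close> change by \<open>t\<close> times a nonnegative
      number.\<close>
    moreover have "\<forall>\<^sub>F t in at_right 0. \<forall>k\<in>{1..m}.
        0 \<le> ((\<Sum>i\<in>UNIV. h i * f i k) - F k) + t * (\<Sum>i\<in>UNIV. d i * f i k)"
      using g d_A
      by (intro eventually_ball_finite ballI eventually_affine_nonneg) (auto simp: A_def)
    ultimately have "\<forall>\<^sub>F t in at_right 0.
        mutual_info phi (\<lambda>i. h i + t * d i) \<le> mutual_info phi h"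
    proof eventually_elim
      case (elim t)
      have "input_distribution (\<lambda>i. h i + t * d i)"
        using elim(1) h d_sum
        by (auto simp: input_distribution_def sum.distrib sum_distrib_left[symmetric])
      moreover have "(\<Sum>i\<in>UNIV. (h i + t * d i) * f i k) =
          (\<Sum>i\<in>UNIV. h i * f i k) + t * (\<Sum>i\<in>UNIV. d i * f i k)" for k
        by (simp add: distrib_right sum.distrib sum_distrib_left mult.assoc)
      ultimately show ?case using elim(2) by (intro max) auto
    qed
    from mutual_info_first_order_condition[OF assms(1) h d_sum d_nonneg this]
    show ?thesis by (simp add: S_def)
  qed
  have lin: "linear (\<lambda>x :: real ^ 'h. \<Sum>i\<in>UNIV. x $ i * c i)" for c
    by (intro linearI) (auto simp: distrib_right sum.distrib sum_distrib_left mult.assoc)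
  have lin1: "linear (\<lambda>x :: real ^ 'h. \<Sum>i\<in>UNIV. x $ i)"
    using lin[of "\<lambda>_. 1"] by simp
  have "finite A" by (simp add: A_def)
  \<comment> \<open>Farkas' lemma with \<open>- S\<close> as the functional that is nonnegative on
    the cone of admissible directions, written as vectors in \<open>real ^ 'h\<close>.\<close>
  then obtain c l where l: "\<forall>k\<in>A. 0 \<le> l k"
    and eq: "\<And>x :: real ^ 'h. (\<Sum>i\<in>UNIV. x $ i * - S i) =
      c * (\<Sum>i\<in>UNIV. x $ i) + (\<Sum>k\<in>A. l k * (\<Sum>i\<in>UNIV. x $ i * f i k))"
    using farkas_linear[OF _ lin1 lin lin[of "\<lambda>i. - S i"], of A "\<lambda>k i. f i k"] first_order
    by (auto simp: sum_negf)
  \<comment> \<open>Index 0 takes the free multiplier \<open>c\<close> of the normalization, plus 1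
    to cancel the \<open>- 1\<close> in the stationarity equation. Constraints with slack get
    multiplier 0.\<close>
  define l' where "l' k = (if k = 0 then 1 + c else if k \<in> A then l k else 0)" for k
  have "S i - 1 + (\<Sum>k=0..m. l' k * f i k) = 0" for i
  proof -
    \<comment> \<open>Evaluating the identity of functionals at the unit vectors reads off one
      equation per input.\<close>
    have unit: "(\<Sum>j\<in>UNIV. axis i (1::real) $ j * y j) = y i" for y :: "'h \<Rightarrow> real"
      by (simp add: axis_def if_distrib[of "\<lambda>x. x * _"] cong: if_cong)
    have "- S i = c + (\<Sum>k\<in>A. l k * f i k)"
      using eq[of "axis i 1"] unit[of "\<lambda>_. 1"] by (simp only: unit mult_1_right)
    moreover have "(\<Sum>k=0..m. l' k * f i k) = l' 0 * f i 0 + (\<Sum>k=1..m. l' k * f i k)"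
      by (simp add: sum.atLeast_Suc_atMost)
    moreover have "(\<Sum>k=1..m. l' k * f i k) = (\<Sum>k\<in>A. l k * f i k)"
      by (rule sum.mono_neutral_cong_right) (auto simp: A_def l'_def)
    ultimately show ?thesis using f0 by (simp add: l'_def)
  qed
  moreover have "\<forall>k\<in>{1..m}. l' k \<ge> 0" using l by (auto simp: l'_def)
  ultimately show ?thesis
    using g h unfolding S_def[symmetric] by (auto simp: input_distribution_def)
qed

end
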